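(* Let $M = \langle 6, 9, 20\rangle$ be the McNugget monoid. For each $x \in M$, $L(x + 6) = L(x) + 1$. In particular, for each $x \in M$, writing $x = 6q + r$ with $q, r$ nonnegative integers and $r < 6$, \[ L(x) = \begin{cases} q & \text{if } r = 0 \text{ or } 3, \\ q - 5 & \text{if } r = 1, \\ q - 2 & \text{if } r = 2 \text{ or } 5, \\ q - 4 & \text{if } r = 4. \end{cases} \]
   Context: The McNugget monoid is $M = \langle 6, 9, 20 \rangle = \{6a + 9b + 20c : a, b, c \in \mathbb{N}_0\}$, a monoid under addition, where $\mathbb{N}_0$ is the set of nonnegative integers. For $x \in M$, the set of factorizations of $x$ is $\mathsf{Z}(x) = \{(a,b,c) \in \mathbb{N}_0^3 : 6a + 9b + 20c = x\}$, the length of a factorization $(a,b,c)$ is $a + b + c$, and the set of lengths of $x$ is $\mathcal{L}(x) = \{a + b + c : (a,b,c) \in \mathsf{Z}(x)\}$, which is a finite nonempty set. Define $L(x) = \max \mathcal{L}(x)$. *)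

theory Defs
  imports Main
begin

definition mcnugget :: "nat set" where
  "mcnugget = {6 * a + 9 * b + 20 * c | a b c. True}"

definition factorizations :: "nat \<Rightarrow> (nat \<times> nat \<times> nat) set" where
  "factorizations x = {(a, b, c). 6 * a + 9 * b + 20 * c = x}"

definition fact_length :: "nat \<times> nat \<times> nat \<Rightarrow> nat" where
  "fact_length = (\<lambda>(a, b, c). a + b + c)"

definition length_set :: "nat \<Rightarrow> nat set" where
  "length_set x = fact_length ` factorizations x"

definition max_length :: "nat \<Rightarrow> nat" where
  "max_length x = Max (length_set x)"

text \<open>The next two facts show that \<^const>\<open>Max\<close> is applied to a finite nonempty set
  whenever the argument lies in the monoid.\<close>

lemma finite_length_set: "finite (length_set x)"
proof -
  have "length_set x \<subseteq> {..x}"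
    by (auto simp: length_set_def factorizations_def fact_length_def)
  then show ?thesis
    by (rule finite_subset) simp
qed

lemma length_set_nonempty_iff: "length_set x \<noteq> {} \<longleftrightarrow> x \<in> mcnugget"
  by (auto simp: length_set_def factorizations_def mcnugget_def)

end

theory Submission imports Defs
begin

text \<open>Since 9 + 9 = 6 + 6 + 6 and 20 + 20 + 20 is ten times 6, every factorization can be traded
  for a longer one until it uses at most one 9 and at most two 20s. These residual multiplicities
  are determined by the element modulo 2 and modulo 3, so the resulting factorization is the
  unique longest one.\<close>

lemma max_length_reduced:
  assumes "b \<le> 1" "c \<le> 2"
  shows "max_length (6 * a + 9 * b + 20 * c) = a + b + c"
  unfolding max_length_def
proof (rule Max_eqI[OF finite_length_set])
  show "a + b + c \<in> length_set (6 * a + 9 * b + 20 * c)"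
    by (force simp: length_set_def factorizations_def fact_length_def)
next
  fix n assume "n \<in> length_set (6 * a + 9 * b + 20 * c)"
  then obtain a' b' c' where n: "n = a' + b' + c'"
    and eq: "6 * a' + 9 * b' + 20 * c' = 6 * a + 9 * b + 20 * c"
    by (auto simp: length_set_def factorizations_def fact_length_def)
  \<comment> \<open>Parity argument: the 6s and 20s are absorbed into \<open>2 * u\<close> and
    \<open>2 * v\<close>, and \<open>b' < b\<close> would make 9 even.\<close>
  have "b \<le> b'" if "2 * u + 9 * b' = 2 * v + 9 * b" for u v :: nat
  proof (rule ccontr)
    assume "\<not> b \<le> b'"
    then have "b = 1" "b' = 0"
      using assms(1) by simp_all
    then have "2 * u = 2 * v + 9"
      using that by simp
    then show False by presburger
  qed
  from this[of "3 * a' + 10 * c'" "3 * a + 10 * c"] have "b \<le> b'"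
    using eq by simp
  \<comment> \<open>The same modulo 3: \<open>c' < c\<close> would make 20 or 40 divisible by
    3.\<close>
  moreover have "c \<le> c'" if "3 * u + 20 * c' = 3 * v + 20 * c" for u v :: nat
  proof (rule ccontr)
    assume "\<not> c \<le> c'"
    then have "c = c' + 1 \<or> c = c' + 2"
      using assms(2) by linarith
    then have "3 * u = 3 * v + 20 \<or> 3 * u = 3 * v + 40"
      using that by auto
    then show False by presburger
  qed
  from this[of "2 * a' + 3 * b'" "2 * a + 3 * b"] have "c \<le> c'"
    using eq by simp
  \<comment> \<open>By \<open>eq\<close>, 6 times (\<open>a + b + c\<close> minus \<open>n\<close>)
    equals 3 times (\<open>b'\<close> minus \<open>b\<close>) plus 14 times (\<open>c'\<close> minus
    \<open>c\<close>), which is nonnegative.\<close>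
  ultimately show "n \<le> a + b + c" using eq n by linarith
qed

lemma mcnugget_reducedE:
  assumes "x \<in> mcnugget"
  obtains a b c where "x = 6 * a + 9 * b + 20 * c" "b \<le> 1" "c \<le> 2"
proof -
  obtain a b c where x: "x = 6 * a + 9 * b + 20 * c"
    using assms by (auto simp: mcnugget_def)
  define k i l j where "k = b div 2" "i = b mod 2" "l = c div 3" "j = c mod 3"
  then have "b = 2 * k + i" "i \<le> 1" "c = 3 * l + j" "j \<le> 2"
    by simp_all
  with x show thesis
    \<comment> \<open>Each of the \<open>k\<close> pairs of 9s becomes three 6s, each of the
      \<open>l\<close> triples of 20s ten 6s.\<close>
    by (intro that[of "a + 3 * k + 10 * l" i j]) simp_all
qed

theorem theorem4p1:
  fixes x :: nat
  assumes "x \<in> mcnugget"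
  shows "max_length (x + 6) = max_length x + 1 \<and>
    (\<forall>q r :: nat. x = 6 * q + r \<and> r < 6 \<longrightarrow>
      int (max_length x) =
        (if r = 0 \<or> r = 3 then int q
         else if r = 1 then int q - 5
         else if r = 2 \<or> r = 5 then int q - 2
         else int q - 4))"
proof -
  obtain a b c where x: "x = 6 * a + 9 * b + 20 * c" and bc: "b \<le> 1" "c \<le> 2"
    using assms by (rule mcnugget_reducedE)
  have L: "max_length x = a + b + c"
    unfolding x using bc by (rule max_length_reduced)
  \<comment> \<open>One more 6 leaves \<open>b\<close> and \<open>c\<close> alone, so the
    factorization stays reduced.\<close>
  have "x + 6 = 6 * (a + 1) + 9 * b + 20 * c"
    using x by simp
  then have "max_length (x + 6) = max_length x + 1"
    unfolding L by (simp only: max_length_reduced[OF bc])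
  moreover have "int (max_length x) =
        (if r = 0 \<or> r = 3 then int q
         else if r = 1 then int q - 5
         else if r = 2 \<or> r = 5 then int q - 2
         else int q - 4)" if "x = 6 * q + r \<and> r < 6" for q r
  proof -
    have qr: "q = x div 6" "r = x mod 6"
      using that by auto
    \<comment> \<open>In this order \<open>9 * b + 20 * c\<close> is 0, 20, 40, 9, 29, 49, with
      residues 0, 2, 4, 3, 5, 1 modulo 6: each residue occurs once.\<close>
    consider "b = 0" "c = 0" | "b = 0" "c = 1" | "b = 0" "c = 2"
      | "b = 1" "c = 0" | "b = 1" "c = 1" | "b = 1" "c = 2"
      using bc by linarith
    then show ?thesis
      unfolding L unfolding qr x by cases simp_all
  qed
  ultimately show ?thesis by blast
qed

end
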